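(* Let $\varphi_{\mathbb C}(z)=z+\sqrt{1+z^2}$ (principal branch of the square root) and $\varphi_e(z)=e^z$ for $z\in\mathbb D$. Then the sharp $\mathcal S^*(\varphi_e)$-radius of $\mathcal S^*(\varphi_{\mathbb C})$ is $$R_{\mathcal S^*(\varphi_e)}(\mathcal S^*(\varphi_{\mathbb C}))=\sin 1.$$
   Context: Let $\mathbb D=\{z\in\mathbb C:|z|<1\}$ and let $\mathcal A$ be the class of functions $f$ analytic on $\mathbb D$ with $f(0)=0$ and $f'(0)=1$. For an analytic function $\varphi$ on $\mathbb D$ with $\varphi(0)=1$, the class $\mathcal S^*(\varphi)$ consists of all $f\in\mathcal A$ with $zf'(z)/f(z)\prec\varphi(z)$; that is, there is an analytic $\omega:\mathbb D\to\mathbb D$ with $\omega(0)=0$ such that $zf'(z)/f(z)=\varphi(\omega(z))$ on $\mathbb D$ (the quotient takes the value $1$ at $z=0$, and $f$ has no other zeros). For two such functions $\varphi_1,\varphi_2$, the sharp $\mathcal S^*(\varphi_2)$-radius of $\mathcal S^*(\varphi_1)$ is $$R_{\mathcal S^*(\varphi_2)}(\mathcal S^*(\varphi_1))=\sup\left\{r\in(0,1]: f_r(z)=\tfrac{f(rz)}{r}\text{ belongs to }\mathcal S^*(\varphi_2)\text{ for every } f\in\mathcal S^*(\varphi_1)\right\}.$$ *)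

theory Defs
  imports "HOL-Analysis.Analysis"
begin

text \<open>
  Functions on the unit disc are total functions on the complex plane, and only their values on
  the open ball \<^term>\<open>ball (0::complex) 1\<close> matter.
\<close>

definition class_A :: "(complex \<Rightarrow> complex) set" where
  "class_A = {f. f holomorphic_on ball 0 1 \<and> f 0 = 0 \<and> deriv f 0 = 1}"

definition subordinate :: "(complex \<Rightarrow> complex) \<Rightarrow> (complex \<Rightarrow> complex) \<Rightarrow> bool" where
  "subordinate g h \<longleftrightarrow>
     (\<exists>\<omega>. \<omega> holomorphic_on ball 0 1 \<and> \<omega> ` ball 0 1 \<subseteq> ball 0 1 \<and> \<omega> 0 = 0 \<and>
          (\<forall>z\<in>ball 0 1. g z = h (\<omega> z)))"

text \<open>The quotient \<open>z f'(z) / f(z)\<close>, with its removable singularity at the origin filled in.\<close>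

definition log_quotient :: "(complex \<Rightarrow> complex) \<Rightarrow> complex \<Rightarrow> complex" where
  "log_quotient f z = (if z = 0 then 1 else z * deriv f z / f z)"

text \<open>
  Meant for \<open>\<phi>\<close> holomorphic on the disc with \<open>\<phi> 0 = 1\<close>. Since division by zero is total, the
  absence of zeros off the origin has to be demanded explicitly.
\<close>

definition starlike_class :: "(complex \<Rightarrow> complex) \<Rightarrow> (complex \<Rightarrow> complex) set" where
  "starlike_class \<phi> =
     {f \<in> class_A. (\<forall>z\<in>ball 0 1 - {0}. f z \<noteq> 0) \<and> subordinate (log_quotient f) \<phi>}"

definition dilation :: "real \<Rightarrow> (complex \<Rightarrow> complex) \<Rightarrow> complex \<Rightarrow> complex" where
  "dilation r f z = f (of_real r * z) / of_real r"

text \<open>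
  The first argument \<open>\<phi>\<^sub>2\<close> gives the target class, the second argument \<open>\<phi>\<^sub>1\<close> the source class.
\<close>

definition starlike_radius :: "(complex \<Rightarrow> complex) \<Rightarrow> (complex \<Rightarrow> complex) \<Rightarrow> real" where
  "starlike_radius \<phi>\<^sub>2 \<phi>\<^sub>1 =
     Sup {r \<in> {0<..1}. \<forall>f\<in>starlike_class \<phi>\<^sub>1. dilation r f \<in> starlike_class \<phi>\<^sub>2}"

definition phi_C :: "complex \<Rightarrow> complex" where
  "phi_C z = z + csqrt (1 + z\<^sup>2)"

definition phi_e :: "complex \<Rightarrow> complex" where
  "phi_e z = exp z"

end

theory Submission
  imports Defs "HOL-Complex_Analysis.Conformal_Mappings"
begin

text \<open>
  On the disc \<open>phi_C w = exp (\<i> * Arcsin (-\<i> * w))\<close>, and \<open>cmod (sin z) \<ge> sin (cmod z)\<close> by Euler's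
  product, so \<open>Arcsin\<close> maps the disc of radius \<open>sin 1\<close> into the unit disc. Together with the
  Schwarz lemma this gives the lower bound. For sharpness, the function with
  \<open>z f'(z) / f(z) = phi_C z\<close> has an elementary closed form, and
  \<open>phi_C (\<i> * sin 1) = exp \<i>\<close>, where \<open>\<i>\<close> is already on the unit circle.
\<close>

section \<open>Estimates for the complex sine and its inverse\<close>

text \<open>Euler's products are compared factor by factor via the reverse triangle inequality, then
  in the limit. The bound \<open>cmod z \<le> pi\<close> makes the real factors nonnegative, so the
  inequalities can be multiplied.\<close>

lemma norm_sin_ge_sin_norm:
  fixes z :: complex
  assumes "cmod z \<le> pi"
  shows "sin (cmod z) \<le> cmod (sin z)"
proof -
  define w where "w = z / of_real pi"
  define x where "x = cmod w"
  have z: "z = of_real pi * w" and x: "cmod z = pi * x" "0 \<le> x" "x \<le> 1"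
    using assms by (auto simp: w_def x_def norm_divide)
  have "(\<lambda>n. cmod (of_real pi * w * (\<Prod>k=1..n. 1 - w^2 / of_nat k^2))) \<longlonglongrightarrow> cmod (sin z)"
    unfolding z by (intro tendsto_norm sin_product_formula_complex)
  moreover have "(\<lambda>n. pi * x * (\<Prod>k=1..n. 1 - x^2 / of_nat k^2)) \<longlonglongrightarrow> sin (cmod z)"
    unfolding x(1) by (rule sin_product_formula_real)
  moreover have "pi * x * (\<Prod>k=1..n. 1 - x^2 / of_nat k^2)
      \<le> cmod (of_real pi * w * (\<Prod>k=1..n. 1 - w^2 / of_nat k^2))" for n
  proof -
    have "(\<Prod>k=1..n. 1 - x^2 / of_nat k^2) \<le> (\<Prod>k=1..n. cmod (1 - w^2 / of_nat k^2))"
    proof (rule prod_mono)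
      fix k assume "k \<in> {1..n}"
      then have "1 \<le> real k" by simp
      with x have "x^2 \<le> real k^2" by (intro power_mono) auto
      then have "0 \<le> 1 - x^2 / of_nat k^2"
        by (simp add: divide_le_eq)
      moreover have "1 - x^2 / of_nat k^2 \<le> cmod (1 - w^2 / of_nat k^2)"
        using norm_triangle_ineq2[of 1 "w^2 / of_nat k^2"]
        by (simp add: x_def norm_divide norm_power)
      ultimately show "0 \<le> 1 - x^2 / of_nat k^2 \<and>
          1 - x^2 / of_nat k^2 \<le> cmod (1 - w^2 / of_nat k^2)" by simp
    qed
    then show ?thesis
      using x by (simp add: norm_mult prod_norm mult_left_mono x_def[symmetric])
  qed
  ultimately show ?thesis
    by (intro LIMSEQ_le) auto
qed

text \<open>Along the segment from 0 to \<open>u\<close> the modulus of \<open>Arcsin\<close> starts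
  at 0. If it reached \<open>r\<close>, the sine estimate there would give
  \<open>sin r \<le> cmod u\<close>. The assumption \<open>cmod u < 1\<close> keeps the segment off
  the branch cuts.\<close>

lemma norm_Arcsin_less:
  assumes u: "cmod u < sin r" and r: "0 < r" "r \<le> pi" and u1: "cmod u < 1"
  shows "cmod (Arcsin u) < r"
proof (rule ccontr)
  assume "\<not> ?thesis"
  moreover have "continuous_on {0..1} (\<lambda>t. cmod (Arcsin (of_real t * u)))"
  proof (intro continuous_at_imp_continuous_on ballI isCont_norm isCont_Arcsin')
    fix t :: real assume t: "t \<in> {0..1}"
    have "\<bar>Re (of_real t * u)\<bar> \<le> t * cmod u"
      using abs_Re_le_cmod[of "of_real t * u"] t by (simp add: norm_mult)
    also have "\<dots> \<le> cmod u" using t by (intro mult_left_le_one_le) auto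
    finally show "\<bar>Re (of_real t * u)\<bar> < 1" using u1 by simp
  qed (intro continuous_intros)
  ultimately obtain t where t: "0 \<le> t" "t \<le> 1" "cmod (Arcsin (of_real t * u)) = r"
    using IVT'[of "\<lambda>t. cmod (Arcsin (of_real t * u))" 0 r 1] r by auto
  have "sin r \<le> t * cmod u"
    using norm_sin_ge_sin_norm[of "Arcsin (of_real t * u)"] t r by (simp add: norm_mult)
  also have "\<dots> \<le> cmod u" using t by (intro mult_left_le_one_le) auto
  finally show False using u by simp
qed

text \<open>\<open>phi_C w\<close> is exactly the argument of the logarithm defining
  \<open>Arcsin\<close> at \<open>- \<i> * w\<close>, and that argument never vanishes.\<close>

lemma phi_C_eq_exp_Arcsin: "phi_C w = exp (\<i> * Arcsin (- \<i> * w))"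
  using Arcsin_body_lemma[of "- \<i> * w"]
  by (simp add: phi_C_def Arcsin_def power_mult_distrib)

section \<open>Dilations and the lower bound for the radius\<close>

lemma log_quotient_dilation:
  assumes f: "f holomorphic_on ball 0 1" and r: "0 < r" and z: "cmod (of_real r * z) < 1"
  shows "(dilation r f has_field_derivative deriv f (of_real r * z)) (at z)"
    and "log_quotient (dilation r f) z = log_quotient f (of_real r * z)"
proof -
  have "(f has_field_derivative deriv f (of_real r * z)) (at (of_real r * z))"
    using f z by (intro holomorphic_derivI[OF f]) auto
  moreover have "((\<lambda>z. of_real r * z) has_field_derivative of_real r) (at z)"
    by (auto intro!: derivative_eq_intros)
  ultimately have "((\<lambda>z. f (of_real r * z)) has_field_derivative deriv f (of_real r * z) * of_real r) (at z)"
    by (rule DERIV_chain2)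
  from DERIV_cdivide[OF this, of "of_real r"]
  show *: "(dilation r f has_field_derivative deriv f (of_real r * z)) (at z)"
    using r by (simp add: dilation_def[abs_def])
  show "log_quotient (dilation r f) z = log_quotient f (of_real r * z)"
    using r by (simp add: log_quotient_def DERIV_imp_deriv[OF *]) (simp add: dilation_def)
qed

text \<open>Normalization and absence of zeros pass to the dilation, so only the subordination has
  to be supplied.\<close>

lemma dilation_starlike:
  assumes f: "f \<in> starlike_class \<phi>" and r: "0 < r" "r \<le> 1"
    and sub: "subordinate (\<lambda>z. log_quotient f (of_real r * z)) \<psi>"
  shows "dilation r f \<in> starlike_class \<psi>"
proof -
  have f': "f holomorphic_on ball 0 1" "f 0 = 0" "deriv f 0 = 1"
    "\<And>z. z \<in> ball 0 1 - {0} \<Longrightarrow> f z \<noteq> 0"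
    using f by (auto simp: starlike_class_def class_A_def)
  have rz: "cmod (of_real r * z) < 1" if "cmod z < 1" for z
    using that r mult_left_le_one_le[of "cmod z" r] by (simp add: norm_mult)
  note D = log_quotient_dilation[OF f'(1) r(1) rz]
  have "dilation r f holomorphic_on ball 0 1"
    unfolding holomorphic_on_open[OF open_ball] using D(1) by (metis mem_ball_0)
  moreover have "deriv (dilation r f) 0 = 1"
    using DERIV_imp_deriv[OF D(1)[of 0]] f' by simp
  moreover have "dilation r f z \<noteq> 0" if "z \<in> ball 0 1 - {0}" for z
    using that f'(4)[of "of_real r * z"] rz[of z] r by (simp add: dilation_def)
  moreover have "subordinate (log_quotient (dilation r f)) \<psi>"
    using sub D(2) by (auto simp: subordinate_def)
  ultimately show ?thesis
    using f' by (auto simp: starlike_class_def class_A_def dilation_def)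
qed

lemma subordinate_exp_dilated_phi_C:
  assumes sub: "subordinate g phi_C" and r: "0 < r" "r \<le> sin 1"
  shows "subordinate (\<lambda>z. g (of_real r * z)) phi_e"
proof -
  obtain \<omega> where \<omega>: "\<omega> holomorphic_on ball 0 1" "\<omega> ` ball 0 1 \<subseteq> ball 0 1" "\<omega> 0 = 0"
    "\<And>z. z \<in> ball 0 1 \<Longrightarrow> g z = phi_C (\<omega> z)"
    using sub unfolding subordinate_def by blast
  have rz: "cmod (of_real r * z) < sin 1" "cmod (of_real r * z) < 1" if "cmod z < 1" for z
  proof -
    have "r * cmod z < r" using that r by simp
    then have "r * cmod z < sin 1" using r by linarith
    then show "cmod (of_real r * z) < sin 1" using r by (simp add: norm_mult)
    then show "cmod (of_real r * z) < 1" using sin_le_one[of 1] by linarith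
  qed
  \<comment> \<open>The Schwarz lemma bounds this modulus by
    \<open>cmod (of_real r * z)\<close>.\<close>
  have \<omega>r: "cmod (\<omega> (of_real r * z)) < sin 1" if "cmod z < 1" for z
    using Schwarz_Lemma(1)[OF \<omega>(1,3) _ rz(2)[OF that]] rz(1)[OF that] \<omega>(2)
    by (force simp: image_subset_iff)
  \<comment> \<open>A holomorphic logarithm of \<open>phi_C (\<omega> (of_real r * z))\<close>; it
    serves as the Schwarz function for \<open>phi_e\<close>.\<close>
  define \<nu> where "\<nu> = (\<lambda>z. \<i> * Arcsin (- \<i> * \<omega> (of_real r * z)))"
  have "(\<lambda>z. \<omega> (of_real r * z)) holomorphic_on ball 0 1"
    using rz(2) by (intro holomorphic_on_compose_gen[OF _ \<omega>(1), unfolded o_def] holomorphic_intros) auto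
  then have inner: "(\<lambda>z. - \<i> * \<omega> (of_real r * z)) holomorphic_on ball 0 1"
    by (intro holomorphic_on_mult holomorphic_on_const)
  have "Arcsin holomorphic_on ball 0 1"
  proof (rule holomorphic_on_Arcsin)
    fix z :: complex assume "z \<in> ball 0 1"
    then show "\<bar>Re z\<bar> < 1" using abs_Re_le_cmod[of z] by simp
  qed
  moreover have one: "cmod (\<omega> (of_real r * z)) < 1" if "cmod z < 1" for z
    using \<omega>r[OF that] sin_le_one[of 1] by linarith
  then have "(\<lambda>z. - \<i> * \<omega> (of_real r * z)) ` ball 0 1 \<subseteq> ball 0 1"
    by (auto simp: norm_mult)
  ultimately have "(Arcsin \<circ> (\<lambda>z. - \<i> * \<omega> (of_real r * z))) holomorphic_on ball 0 1"
    by (rule holomorphic_on_compose_gen[OF inner])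
  then have "\<nu> holomorphic_on ball 0 1"
    unfolding \<nu>_def o_def by (rule holomorphic_on_mult[OF holomorphic_on_const])
  moreover have "cmod (\<nu> z) < 1" if "cmod z < 1" for z
    unfolding \<nu>_def norm_mult norm_ii mult_1
    by (rule norm_Arcsin_less) (use \<omega>r[OF that] one[OF that] pi_gt3 in \<open>simp_all add: norm_mult\<close>)
  then have "\<nu> ` ball 0 1 \<subseteq> ball 0 1" by auto
  moreover have "\<nu> 0 = 0" by (simp add: \<nu>_def \<omega>)
  moreover have "g (of_real r * z) = phi_e (\<nu> z)" if "z \<in> ball 0 1" for z
    using that rz(2)[of z] \<omega>(4) by (simp add: phi_e_def \<nu>_def phi_C_eq_exp_Arcsin)
  ultimately show ?thesis
    unfolding subordinate_def by blast
qed

section \<open>The extremal function\<close>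

text \<open>The principal root has nonnegative real part, so it is never -1. This keeps the
  denominator of the extremal function away from 0.\<close>

lemma one_plus_csqrt_nonzero: "1 + csqrt z \<noteq> 0"
proof
  assume "1 + csqrt z = 0"
  then have "csqrt z = - 1" by (simp add: add_eq_0_iff)
  then show False using csqrt_principal[of z] by (simp del: csqrt.sel)
qed

text \<open>On the disc \<open>1 + z\<^sup>2\<close> has positive real part, so \<open>csqrt\<close>
  is differentiable and nonzero there.\<close>

lemma one_plus_square_notin_nonpos_Reals:
  assumes "cmod z < 1"
  shows "1 + z\<^sup>2 \<notin> \<real>\<^sub>\<le>\<^sub>0"
proof -
  have "cmod (z\<^sup>2) < 1" using assms by (simp add: norm_power power_less_one_iff)
  then have "Re (1 + z\<^sup>2) > 0" using abs_Re_le_cmod[of "z\<^sup>2"] by simp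
  then show ?thesis by (simp add: complex_nonpos_Reals_iff)
qed

text \<open>With \<open>s = csqrt (1 + z\<^sup>2)\<close>, an antiderivative of \<open>(phi_C z - 1) / z\<close> is \<open>z + s - ln (1 + s)\<close>.\<close>

definition extremal_C :: "complex \<Rightarrow> complex" where
  "extremal_C z = 2 * z * exp (phi_C z - 1) / (1 + csqrt (1 + z\<^sup>2))"

text \<open>The derivative is \<open>extremal_C z / z * phi_C z\<close> with the factor
  \<open>z\<close> cancelled, so the formula also covers the origin.\<close>

lemma has_field_derivative_extremal_C:
  assumes "cmod z < 1"
  shows "(extremal_C has_field_derivative
    2 * exp (phi_C z - 1) / (1 + csqrt (1 + z\<^sup>2)) * phi_C z) (at z)"
proof -
  define s where "s = csqrt (1 + z\<^sup>2)"
  have s: "s \<noteq> 0" "1 + s \<noteq> 0" "s * s = 1 + z * z"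
    using one_plus_square_notin_nonpos_Reals[OF assms] one_plus_csqrt_nonzero[of "1 + z\<^sup>2"]
      power2_csqrt[of "1 + z\<^sup>2"]
    unfolding s_def power2_eq_square[symmetric] by force+
  define E where "E = exp (z + s - 1)"
  \<comment> \<open>The raw quotient rule, with \<open>z / s\<close> as the derivative of
    \<open>s\<close>.\<close>
  have "(extremal_C has_field_derivative
      ((2 * E + 2 * z * (E * (1 + z / s))) * (1 + s) - 2 * z * E * (z / s)) / ((1 + s) * (1 + s))) (at z)"
    unfolding extremal_C_def[abs_def] phi_C_def[abs_def]
    using one_plus_square_notin_nonpos_Reals[OF assms] s
    by (auto intro!: derivative_eq_intros simp: s_def[symmetric] E_def)
  also have "((2 * E + 2 * z * (E * (1 + z / s))) * (1 + s) - 2 * z * E * (z / s)) / ((1 + s) * (1 + s))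
      = 2 * E / (1 + s) * (z + s)"
  proof -
    \<comment> \<open>Naming the quotient leaves a polynomial identity modulo
      \<open>s * q = z\<close> and \<open>s * s = 1 + z * z\<close>.\<close>
    define q where "q = z / s"
    have q: "s * q = z" using s by (simp add: q_def)
    have "(2 * E + 2 * z * (E * (1 + q))) * (1 + s) - 2 * z * E * q
        = 2 * E * (1 + s + z + z * s + z * (s * q))"
      by (simp add: algebra_simps)
    also have "1 + s + z + z * s + z * (s * q) = (1 + s) * (z + s)"
      using s(3) unfolding q by (simp add: algebra_simps)
    finally show ?thesis using s(2) unfolding q_def by simp
  qed
  finally show ?thesis by (simp add: phi_C_def s_def E_def)
qed

lemma log_quotient_extremal_C:
  assumes "cmod z < 1"
  shows "log_quotient extremal_C z = phi_C z"
proof (cases "z = 0")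
  case False
  then show ?thesis
    using DERIV_imp_deriv[OF has_field_derivative_extremal_C[OF assms]]
      one_plus_csqrt_nonzero[of "1 + z\<^sup>2"]
    by (simp add: log_quotient_def extremal_C_def)
qed (simp add: log_quotient_def phi_C_def)

lemma extremal_C_holomorphic: "extremal_C holomorphic_on ball 0 1"
  unfolding holomorphic_on_open[OF open_ball]
  using has_field_derivative_extremal_C by (metis mem_ball_0)

lemma extremal_C_starlike: "extremal_C \<in> starlike_class phi_C"
proof -
  have "deriv extremal_C 0 = 1"
    using DERIV_imp_deriv[OF has_field_derivative_extremal_C[of 0]] by (simp add: phi_C_def)
  moreover have "extremal_C z \<noteq> 0" if "z \<noteq> 0" for z
    using that one_plus_csqrt_nonzero by (simp add: extremal_C_def)
  moreover have "subordinate (log_quotient extremal_C) phi_C"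
    unfolding subordinate_def
    by (rule exI[of _ "\<lambda>z. z"]) (auto simp: log_quotient_extremal_C)
  ultimately show ?thesis
    using extremal_C_holomorphic by (auto simp: starlike_class_def class_A_def extremal_C_def)
qed

text \<open>The sign condition makes the principal root of \<open>1 - sin\<^sup>2 x\<close> equal to
  \<open>cos x\<close> rather than its negative; Euler's formula does the rest.\<close>

lemma phi_C_i_sin:
  assumes "0 \<le> cos x"
  shows "phi_C (\<i> * of_real (sin x)) = exp (\<i> * of_real x)"
proof -
  have "1 + (\<i> * of_real (sin x))\<^sup>2 = (of_real (cos x) :: complex)\<^sup>2"
    by (simp add: power_mult_distrib cos_squared_eq del: of_real_power flip: of_real_power)
  moreover have "csqrt ((of_real (cos x))\<^sup>2) = of_real (cos x)"
    using assms by (simp flip: of_real_power)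
  ultimately show ?thesis
    by (simp add: phi_C_def exp_Euler sin_of_real cos_of_real)
qed

section \<open>Sharpness and conclusion\<close>

lemma dilation_extremal_C_radius_le:
  assumes r: "0 < r" "r \<le> 1" and dil: "dilation r extremal_C \<in> starlike_class phi_e"
  shows "r \<le> sin 1"
proof (rule ccontr)
  assume "\<not> ?thesis"
  have sin1: "0 < sin (1::real)" and cos1: "0 \<le> cos (1::real)"
    using pi_gt3 by (auto intro: sin_gt_zero cos_ge_zero)
  obtain \<omega> where \<omega>: "\<omega> ` ball 0 1 \<subseteq> ball 0 1"
    "\<And>z. z \<in> ball 0 1 \<Longrightarrow> log_quotient (dilation r extremal_C) z = phi_e (\<omega> z)"
    using dil unfolding starlike_class_def subordinate_def by blast
  \<comment> \<open>If \<open>sin 1 < r\<close>, this point lies in the disc, and the dilation sends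
    it to \<open>\<i> * sin 1\<close>, where \<open>phi_C\<close> equals
    \<open>exp \<i>\<close>.\<close>
  define z :: complex where "z = \<i> * of_real (sin 1 / r)"
  have z: "cmod z < 1" "of_real r * z = \<i> * of_real (sin 1)"
    using \<open>\<not> r \<le> sin 1\<close> r sin1 by (auto simp: z_def norm_mult norm_divide)
  have rz: "cmod (of_real r * z) < 1"
    using \<open>\<not> r \<le> sin 1\<close> r sin1 by (simp add: z(2) norm_mult)
  have "exp (\<omega> z) = phi_C (\<i> * of_real (sin 1))"
    using \<omega>(2)[of z] log_quotient_dilation(2)[OF extremal_C_holomorphic r(1) rz]
      log_quotient_extremal_C[OF rz] z by (simp add: phi_e_def)
  also have "\<dots> = exp \<i>"
    using phi_C_i_sin[OF cos1] by simp
  finally have e: "exp (\<omega> z) = exp \<i>" .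
  have n: "cmod (\<omega> z) < 1" using \<omega>(1) z by (force simp: image_subset_iff)
  \<comment> \<open>With imaginary parts less than a period apart, equal exponentials force
    \<open>\<omega> z = \<i>\<close>, which lies outside the open disc.\<close>
  then have "\<bar>Im (\<omega> z) - Im \<i>\<bar> < 2 * pi"
    using abs_Im_le_cmod[of "\<omega> z"] pi_gt3 by simp
  then have "\<omega> z = \<i>" using e by (rule exp_complex_eqI)
  with n show False by simp
qed

theorem theorem8p1:
  shows "starlike_radius phi_e phi_C = sin 1"
  unfolding starlike_radius_def
\<comment> \<open>The supremum is attained: \<open>sin 1\<close> itself is an admissible
  radius.\<close>
proof (rule cSup_eq_maximum)
  have sin1: "0 < sin (1::real)"
    using pi_gt3 by (auto intro: sin_gt_zero)
  have "dilation (sin 1) f \<in> starlike_class phi_e" if f: "f \<in> starlike_class phi_C" for f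
    using dilation_starlike[OF f sin1 sin_le_one] subordinate_exp_dilated_phi_C[OF _ sin1 order_refl] f
    by (auto simp: starlike_class_def)
  then show "sin 1 \<in> {r \<in> {0<..1}. \<forall>f\<in>starlike_class phi_C. dilation r f \<in> starlike_class phi_e}"
    using sin1 by auto
next
  fix r assume "r \<in> {r \<in> {0<..1}. \<forall>f\<in>starlike_class phi_C. dilation r f \<in> starlike_class phi_e}"
  then show "r \<le> sin 1"
    using dilation_extremal_C_radius_le extremal_C_starlike by auto
qed

end
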